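(* Let $M,N\in\mathbb{S}^{q+r}$. If there exists a real $\alpha\ge 0$ such that $M-\alpha N\ge 0$, then $\mathcal{Z}_r(N)\subseteq\mathcal{Z}_r(M)$. Moreover, if $N\in\boldsymbol{\Pi}_{q,r}$ and $N$ has at least one positive eigenvalue, then $\mathcal{Z}_r(N)\subseteq\mathcal{Z}_r(M)$ if and only if there exists a real $\alpha\ge 0$ such that $M-\alpha N\ge 0$.
   Context: $\mathbb{S}^k$ denotes the real symmetric $k\times k$ matrices; for symmetric matrices, $A\ge 0$ means positive semidefinite. $A^\dagger$ is the Moore–Penrose pseudo-inverse. Any $N\in\mathbb{S}^{q+r}$ is partitioned as $N=\begin{bmatrix}N_{11}&N_{12}\\ N_{21}&N_{22}\end{bmatrix}$ with $N_{11}\in\mathbb{S}^q$, $N_{22}\in\mathbb{S}^r$. The generalized Schur complement is $N\mid N_{22}:=N_{11}-N_{12}N_{22}^\dagger N_{21}$. The set $\boldsymbol{\Pi}_{q,r}$ consists of all $N\in\mathbb{S}^{q+r}$ with $N_{22}\le 0$, $N\mid N_{22}\ge 0$ and $\ker N_{22}\subseteq\ker N_{12}$. Define $\mathcal{Z}_r(\Pi)=\{Z\in\mathbb{R}^{r\times q}:\begin{bmatrix}I_q\\ Z\end{bmatrix}^\top\Pi\begin{bmatrix}I_q\\ Z\end{bmatrix}\ge 0\}$. *)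

theory Defs
  imports "HOL-Analysis.Analysis"
begin

text \<open>Matrices in S^{q+r} are modelled as real^('q+'r)^('q+'r); the first q
coordinates are Inl i, the last r coordinates are Inr j.\<close>

definition sym_mat :: "real^'n^'n \<Rightarrow> bool" where
  "sym_mat A \<longleftrightarrow> transpose A = A"

definition psd :: "real^'n^'n \<Rightarrow> bool" where
  "psd A \<longleftrightarrow> sym_mat A \<and> (\<forall>x. 0 \<le> x \<bullet> (A *v x))"

definition nsd :: "real^'n^'n \<Rightarrow> bool" where
  "nsd A \<longleftrightarrow> sym_mat A \<and> (\<forall>x. x \<bullet> (A *v x) \<le> 0)"

text \<open>Moore-Penrose pseudo-inverse via the four Penrose conditions.\<close>
definition pinv :: "real^'n^'m \<Rightarrow> real^'m^'n" where
  "pinv A = (THE X. A ** X ** A = A \<and> X ** A ** X = X \<and>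
                    transpose (A ** X) = A ** X \<and> transpose (X ** A) = X ** A)"

definition mker :: "real^'n^'m \<Rightarrow> (real^'n) set" where
  "mker A = {x. A *v x = 0}"

definition blk11 :: "real^('q::finite+'r::finite)^('q+'r) \<Rightarrow> real^'q^'q" where
  "blk11 N = (\<chi> i j. N $ Inl i $ Inl j)"
definition blk12 :: "real^('q::finite+'r::finite)^('q+'r) \<Rightarrow> real^'r^'q" where
  "blk12 N = (\<chi> i j. N $ Inl i $ Inr j)"
definition blk21 :: "real^('q::finite+'r::finite)^('q+'r) \<Rightarrow> real^'q^'r" where
  "blk21 N = (\<chi> i j. N $ Inr i $ Inl j)"
definition blk22 :: "real^('q::finite+'r::finite)^('q+'r) \<Rightarrow> real^'r^'r" where
  "blk22 N = (\<chi> i j. N $ Inr i $ Inr j)"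

text \<open>Generalized Schur complement N | N22.\<close>
definition schur :: "real^('q::finite+'r::finite)^('q+'r) \<Rightarrow> real^'q^'q" where
  "schur N = blk11 N - blk12 N ** pinv (blk22 N) ** blk21 N"

definition PiSet :: "(real^('q::finite+'r::finite)^('q+'r)) set" where
  "PiSet = {N. sym_mat N \<and> nsd (blk22 N) \<and> psd (schur N) \<and> mker (blk22 N) \<subseteq> mker (blk12 N)}"

text \<open>The (q+r) x q matrix [I; Z].\<close>
definition stackI :: "real^'q::finite^'r::finite \<Rightarrow> real^'q^('q+'r)" where
  "stackI Z = (\<chi> i j. case i of Inl a \<Rightarrow> (if a = j then 1 else 0) | Inr b \<Rightarrow> Z $ b $ j)"

definition Zr :: "real^('q::finite+'r::finite)^('q+'r) \<Rightarrow> (real^'q^'r) set" where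
  "Zr P = {Z. psd (transpose (stackI Z) ** P ** stackI Z)}"

definition has_pos_eigenvalue :: "real^'n^'n \<Rightarrow> bool" where
  "has_pos_eigenvalue A \<longleftrightarrow> (\<exists>c>0. \<exists>v. v \<noteq> 0 \<and> A *v v = c *\<^sub>R v)"

end

theory Submission
  imports Defs
begin

text \<open>If \<open>M - \<alpha>N \<ge> 0\<close>, the quadratic form of \<open>M\<close> dominates \<open>\<alpha>\<close> times that of \<open>N\<close>, so it is
  nonnegative on the graph of every \<open>Z \<in> \<Z>\<^sub>r(N)\<close>. Conversely, for \<open>N \<in> \<Pi>\<^sub>q\<^sub>,\<^sub>r\<close> put
  \<open>Y = N\<^sub>2\<^sub>2\<^sup>\<dagger> N\<^sub>2\<^sub>1\<close>; the kernel condition gives \<open>N\<^sub>2\<^sub>1 = N\<^sub>2\<^sub>2 Y\<close> and hence the completed square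
  \<open>(x, w - Yx)\<^sup>T N (x, w - Yx) = x\<^sup>T (N|N\<^sub>2\<^sub>2) x + w\<^sup>T N\<^sub>2\<^sub>2 w\<close>. Since the Schur complement is
  positive semidefinite and \<open>N\<^sub>2\<^sub>2\<close> negative semidefinite, every vector \<open>(x, y)\<close> with \<open>x \<noteq> 0\<close> on which \<open>N\<close> is
  nonnegative lies on the graph of a matrix \<open>w l\<^sup>T - Y \<in> \<Z>\<^sub>r(N)\<close>, and vectors \<open>(0, y)\<close> are
  leading directions of a line of such graphs. So \<open>\<Z>\<^sub>r(N) \<subseteq> \<Z>\<^sub>r(M)\<close> makes \<open>M\<close> nonnegative
  wherever \<open>N\<close> is, and a positive eigenvalue of \<open>N\<close> supplies the strict feasibility needed by
  the S-lemma, which yields the multiplier \<open>\<alpha>\<close>.\<close>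

section \<open>Quadratic forms\<close>

lemma inner_matrix_vector_transpose:
  "x \<bullet> ((A::real^'n^'m) *v y) = (transpose A *v x) \<bullet> y"
  by (simp add: dot_lmul_matrix)

lemma sym_mat_inner_commute:
  "sym_mat A \<Longrightarrow> x \<bullet> ((A::real^'n^'n) *v y) = (A *v x) \<bullet> y"
  by (metis inner_matrix_vector_transpose sym_mat_def)

lemma sym_matI:
  assumes "\<And>x y. ((A::real^'n^'n) *v x) \<bullet> y = x \<bullet> (A *v y)"
  shows "sym_mat A"
proof -
  have "transpose A *v y = A *v y" for y
  proof -
    have "x \<bullet> (transpose A *v y - A *v y) = 0" for x
      using assms[of x y] inner_matrix_vector_transpose[of x "transpose A" y]
      by (simp add: inner_diff_right)
    then show ?thesis
      by (metis eq_iff_diff_eq_0 inner_eq_zero_iff)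
  qed
  then show ?thesis
    by (simp add: sym_mat_def matrix_eq)
qed

lemma sym_mat_diff_scaleR:
  "sym_mat (A::real^'n^'n) \<Longrightarrow> sym_mat B \<Longrightarrow> sym_mat (B - c *\<^sub>R A)"
  by (simp add: sym_mat_def transpose_scalar vec_eq_iff transpose_def)

lemma quadratic_form_diff_scaleR:
  "v \<bullet> ((B - c *\<^sub>R A) *v v) = v \<bullet> (B *v v) - c * (v \<bullet> ((A::real^'n^'n) *v v))"
  by (simp add: matrix_vector_mult_diff_rdistrib inner_diff_right
      scaleR_matrix_vector_assoc[symmetric])

lemma quadratic_form_add_scaleR:
  assumes "sym_mat (A::real^'n^'n)"
  shows "(u + t *\<^sub>R v) \<bullet> (A *v (u + t *\<^sub>R v)) =
         u \<bullet> (A *v u) + 2 * (u \<bullet> (A *v v)) * t + (v \<bullet> (A *v v)) * t^2"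
proof -
  have "v \<bullet> (A *v u) = u \<bullet> (A *v v)"
    using sym_mat_inner_commute[OF assms, of v u] by (simp add: inner_commute)
  then show ?thesis
    by (simp add: matrix_vector_right_distrib matrix_vector_mult_scaleR inner_add_left
        inner_add_right algebra_simps power2_eq_square)
qed

lemma nonneg_quadratic_coeffs:
  fixes A B C :: real
  assumes nonneg: "\<And>t. 0 \<le> A + 2*B*t + C*t^2"
  shows "0 \<le> C \<and> B^2 \<le> A*C"
proof -
  have C: "0 \<le> C"
  proof (rule ccontr)
    assume "\<not> 0 \<le> C"
    define t where "t = sqrt ((\<bar>A\<bar> + 1) / (-C))"
    have "0 \<le> (\<bar>A\<bar> + 1) / (-C)"
      using \<open>\<not> 0 \<le> C\<close> by (intro divide_nonneg_pos) auto
    then have "C * t^2 = - (\<bar>A\<bar> + 1)"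
      unfolding t_def using \<open>\<not> 0 \<le> C\<close> by simp
    moreover have "0 \<le> (A + 2*B*t + C*t^2) + (A + 2*B*(-t) + C*(-t)^2)"
      using nonneg[of t] nonneg[of "-t"] by linarith
    ultimately show False
      by (simp add: power2_eq_square)
  qed
  have "B^2 \<le> A*C"
  proof (cases "C = 0")
    case True
    have "B = 0"
    proof (rule ccontr)
      assume "B \<noteq> 0"
      then have "A + 2*B*(-(\<bar>A\<bar>+1)/(2*B)) = A - (\<bar>A\<bar>+1)"
        by (simp add: field_simps)
      then show False
        using nonneg[of "-(\<bar>A\<bar>+1)/(2*B)"] True by simp
    qed
    then show ?thesis using True by simp
  next
    case False
    then have "C > 0" using C by simp
    have "0 \<le> A + 2*B*(-B/C) + C*(-B/C)^2" using nonneg by blast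
    also have "\<dots> = (A*C - B^2) / C"
      using \<open>C > 0\<close> by (simp add: field_simps power2_eq_square)
    finally show ?thesis
      using \<open>C > 0\<close> by (simp add: zero_le_divide_iff)
  qed
  with C show ?thesis by simp
qed

lemma psd_Cauchy_Schwarz:
  assumes "psd (S::real^'n^'n)"
  shows "(x \<bullet> (S *v y))^2 \<le> (x \<bullet> (S *v x)) * (y \<bullet> (S *v y))"
proof -
  have "sym_mat S"
    using assms by (simp add: psd_def)
  have "0 \<le> x \<bullet> (S *v x) + 2 * (x \<bullet> (S *v y)) * t + (y \<bullet> (S *v y)) * t^2" for t
    using assms quadratic_form_add_scaleR[OF \<open>sym_mat S\<close>, of x t y] unfolding psd_def by metis
  then show ?thesis
    using nonneg_quadratic_coeffs by blast
qed

text \<open>For \<open>x\<bullet>Sx > 0\<close> take \<open>l = Sx / x\<bullet>Sx\<close> and use Cauchy-Schwarz for \<open>S\<close>; for \<open>x\<bullet>Sx = 0\<close>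
  the hypotheses force \<open>\<delta> = 0\<close>.\<close>
lemma psd_rank_one_perturbation:
  fixes S :: "real^'n^'n"
  assumes "psd S" "x \<noteq> 0" "0 \<le> x \<bullet> (S *v x) + \<delta>" "\<delta> \<le> 0"
  shows "\<exists>l. l \<bullet> x = 1 \<and> (\<forall>x'. 0 \<le> x' \<bullet> (S *v x') + (l \<bullet> x')^2 * \<delta>)"
proof (cases "x \<bullet> (S *v x) > 0")
  case True
  define \<sigma> where "\<sigma> = x \<bullet> (S *v x)"
  define l where "l = (1 / \<sigma>) *\<^sub>R (S *v x)"
  have "sym_mat S"
    using \<open>psd S\<close> by (simp add: psd_def)
  then have l_inner: "l \<bullet> x' = (x \<bullet> (S *v x')) / \<sigma>" for x'
    unfolding l_def using sym_mat_inner_commute[of S x x'] by simp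
  have "0 \<le> x' \<bullet> (S *v x') + (l \<bullet> x')^2 * \<delta>" for x'
  proof -
    let ?b = "x \<bullet> (S *v x')"
    have "?b^2 \<le> \<sigma> * (x' \<bullet> (S *v x'))"
      unfolding \<sigma>_def by (rule psd_Cauchy_Schwarz[OF \<open>psd S\<close>])
    then have "(?b / \<sigma>)^2 * \<sigma> \<le> x' \<bullet> (S *v x')"
      using True \<sigma>_def by (simp add: power2_eq_square field_simps)
    moreover have "0 \<le> (?b / \<sigma>)^2 * (\<sigma> + \<delta>)"
      using assms(3) \<sigma>_def by simp
    ultimately show ?thesis
      unfolding l_inner by (simp add: algebra_simps)
  qed
  moreover have "l \<bullet> x = 1"
    using True unfolding l_inner \<sigma>_def by simp
  ultimately show ?thesis by blast
next
  case False
  then have "\<delta> = 0"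
    using assms by (simp add: psd_def)
  moreover have "((1 / (x \<bullet> x)) *\<^sub>R x) \<bullet> x = 1"
    using \<open>x \<noteq> 0\<close> by simp
  ultimately show ?thesis
    using \<open>psd S\<close> unfolding psd_def by (metis add.right_neutral mult_zero_right)
qed

section \<open>The S-lemma\<close>

text \<open>Evaluate the second quadratic at the two roots \<open>t\<^sub>1 < 0 < t\<^sub>2\<close> of the first one;
  the combination \<open>t\<^sub>2 f(t\<^sub>1) - t\<^sub>1 f(t\<^sub>2) = (t\<^sub>2 - t\<^sub>1)(p - r t\<^sub>1 t\<^sub>2)\<close> is nonnegative, and
  \<open>t\<^sub>1 t\<^sub>2 = a/c\<close>.\<close>
lemma quadratic_nonneg_transfer:
  fixes a b c p q r :: real
  assumes "a > 0" and "c < 0"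
    and transfer: "\<And>t. 0 \<le> a + 2*b*t + c*t^2 \<Longrightarrow> 0 \<le> p + 2*q*t + r*t^2"
  shows "p * c \<le> r * a"
proof -
  define d where "d = sqrt (b^2 - a*c)"
  have "a * c < 0"
    using assms by (simp add: mult_pos_neg)
  then have "b^2 - a*c > 0"
    using zero_le_power2[of b] by linarith
  then have "d > 0" and d2: "d^2 = b^2 - a*c"
    unfolding d_def by simp_all
  have root: "a + 2*b*t + c*t^2 = 0" if "c*t = -b + s" "s^2 = d^2" for t s
  proof -
    have "c * (a + 2*b*t + c*t^2) = a*c + 2*b*(c*t) + (c*t)^2"
      by (simp add: algebra_simps power2_eq_square)
    also have "\<dots> = 0"
      unfolding that(1) using that(2) d2 by (simp add: algebra_simps power2_eq_square)
    finally show ?thesis using \<open>c < 0\<close> by simp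
  qed
  define t1 where "t1 = (-b + d) / c"
  define t2 where "t2 = (-b - d) / c"
  have ct1: "c*t1 = -b + d" and ct2: "c*t2 = -b + (-d)"
    unfolding t1_def t2_def using \<open>c < 0\<close> by simp_all
  have f1: "0 \<le> p + 2*q*t1 + r*t1^2" and f2: "0 \<le> p + 2*q*t2 + r*t2^2"
    using transfer root[OF ct1] root[OF ct2] by simp_all
  have "t2 - t1 = -2*d/c"
    unfolding t1_def t2_def using \<open>c < 0\<close> by (simp add: field_simps)
  then have t12: "t2 - t1 > 0"
    using \<open>d > 0\<close> \<open>c < 0\<close> by (simp add: divide_pos_neg)
  have "c * (c * (t1 * t2)) = (-b + d) * (-b - d)"
    using ct1 ct2 by (metis minus_real_def mult.assoc mult.left_commute)
  also have "\<dots> = c * a"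
    using d2 by (simp add: algebra_simps power2_eq_square)
  finally have prod: "t1 * t2 = a / c"
    using \<open>c < 0\<close> by (simp add: field_simps)
  then have "t1 * t2 < 0"
    using assms by (simp add: divide_pos_neg)
  then have "t1 < 0" "t2 > 0"
    using t12 by (auto simp: mult_less_0_iff)
  then have "0 \<le> t2 * (p + 2*q*t1 + r*t1^2) + (-t1) * (p + 2*q*t2 + r*t2^2)"
    using mult_nonneg_nonneg[OF _ f1, of t2] mult_nonneg_nonneg[OF _ f2, of "-t1"] by linarith
  also have "\<dots> = (t2 - t1) * (p - r * (t1 * t2))"
    by (simp add: algebra_simps power2_eq_square)
  finally have "0 \<le> p - r * (a / c)"
    using t12 prod by (simp add: zero_le_mult_iff)
  then show ?thesis
    using \<open>c < 0\<close> by (simp add: field_simps)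
qed

text \<open>The multiplier is the infimum of \<open>v\<bullet>Bv / v\<bullet>Av\<close> over the cone where \<open>A\<close> is positive;
  the two-root argument above shows that it dominates the same quotient on the cone where \<open>A\<close>
  is negative.\<close>
lemma S_lemma:
  fixes A B :: "real^'n^'n"
  assumes "sym_mat A" and "sym_mat B" and "v0 \<bullet> (A *v v0) > 0"
    and imp: "\<And>v. 0 \<le> v \<bullet> (A *v v) \<Longrightarrow> 0 \<le> v \<bullet> (B *v v)"
  shows "\<exists>\<alpha>\<ge>0. psd (B - \<alpha> *\<^sub>R A)"
proof -
  define R where "R = {v \<bullet> (B *v v) / (v \<bullet> (A *v v)) | v. v \<bullet> (A *v v) > 0}"
  have "R \<noteq> {}" and R_nonneg: "\<forall>x\<in>R. 0 \<le> x"
    using assms(3) imp unfolding R_def by (auto intro: divide_nonneg_pos)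
  define \<alpha> where "\<alpha> = Inf R"
  have "0 \<le> \<alpha>"
    unfolding \<alpha>_def using \<open>R \<noteq> {}\<close> R_nonneg by (intro cInf_greatest) auto
  have low: "\<alpha> \<le> v \<bullet> (B *v v) / (v \<bullet> (A *v v))" if "v \<bullet> (A *v v) > 0" for v
    unfolding \<alpha>_def using R_nonneg that by (intro cInf_lower) (auto simp: R_def bdd_below_def)
  have high: "v \<bullet> (B *v v) / (v \<bullet> (A *v v)) \<le> \<alpha>" if neg: "v \<bullet> (A *v v) < 0" for v
    unfolding \<alpha>_def
  proof (rule cInf_greatest[OF \<open>R \<noteq> {}\<close>])
    fix x assume "x \<in> R"
    then obtain u where x: "x = u \<bullet> (B *v u) / (u \<bullet> (A *v u))" and pos: "u \<bullet> (A *v u) > 0"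
      unfolding R_def by blast
    have "(u \<bullet> (B *v u)) * (v \<bullet> (A *v v)) \<le> (v \<bullet> (B *v v)) * (u \<bullet> (A *v u))"
    proof (rule quadratic_nonneg_transfer[OF pos neg])
      fix t :: real
      assume "0 \<le> u \<bullet> (A *v u) + 2 * (u \<bullet> (A *v v)) * t + v \<bullet> (A *v v) * t^2"
      then have "0 \<le> (u + t *\<^sub>R v) \<bullet> (B *v (u + t *\<^sub>R v))"
        using imp quadratic_form_add_scaleR[OF \<open>sym_mat A\<close>] by simp
      then show "0 \<le> u \<bullet> (B *v u) + 2 * (u \<bullet> (B *v v)) * t + v \<bullet> (B *v v) * t^2"
        using quadratic_form_add_scaleR[OF \<open>sym_mat B\<close>] by simp
    qed
    then show "v \<bullet> (B *v v) / (v \<bullet> (A *v v)) \<le> x"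
      unfolding x using pos neg by (simp add: field_simps)
  qed
  have "\<alpha> * (v \<bullet> (A *v v)) \<le> v \<bullet> (B *v v)" for v
  proof (cases "v \<bullet> (A *v v)" "0::real" rule: linorder_cases)
    case less
    then show ?thesis using high[OF less] by (simp add: divide_le_eq mult.commute)
  next
    case equal
    then show ?thesis using imp[of v] by simp
  next
    case greater
    then show ?thesis using low[OF greater] by (simp add: le_divide_eq mult.commute)
  qed
  then have "psd (B - \<alpha> *\<^sub>R A)"
    using sym_mat_diff_scaleR[OF assms(1,2)] by (simp add: psd_def quadratic_form_diff_scaleR)
  with \<open>0 \<le> \<alpha>\<close> show ?thesis by blast
qed

lemma has_pos_eigenvalue_imp_quadratic_form_pos:
  assumes "has_pos_eigenvalue A"
  shows "\<exists>v. 0 < v \<bullet> (A *v v)"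
proof -
  obtain c v where "c > 0" "v \<noteq> 0" "A *v v = c *\<^sub>R v"
    using assms unfolding has_pos_eigenvalue_def by blast
  then have "0 < v \<bullet> (A *v v)"
    by simp
  then show ?thesis ..
qed

section \<open>The Moore-Penrose inverse of a symmetric matrix\<close>

definition penrose_inverse :: "real^'n^'m \<Rightarrow> real^'m^'n \<Rightarrow> bool" where
  "penrose_inverse A X \<longleftrightarrow> A ** X ** A = A \<and> X ** A ** X = X \<and>
                    transpose (A ** X) = A ** X \<and> transpose (X ** A) = X ** A"

lemma penrose_inverse_unique:
  assumes "penrose_inverse A X" "penrose_inverse A Y"
  shows "X = Y"
proof -
  have X: "A ** X ** A = A" "X ** A ** X = X" "transpose (A ** X) = A ** X" "transpose (X ** A) = X ** A"
    using assms(1) by (auto simp: penrose_inverse_def)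
  have Y: "A ** Y ** A = A" "Y ** A ** Y = Y" "transpose (A ** Y) = A ** Y" "transpose (Y ** A) = Y ** A"
    using assms(2) by (auto simp: penrose_inverse_def)
  have "X = X ** transpose (A ** X)"
    using X by (simp add: matrix_mul_assoc)
  also have "\<dots> = X ** transpose X ** transpose (A ** Y ** A)"
    using Y by (simp add: matrix_transpose_mul matrix_mul_assoc)
  also have "\<dots> = X ** transpose (A ** X) ** transpose (A ** Y)"
    by (simp add: matrix_transpose_mul matrix_mul_assoc)
  also have "\<dots> = X ** (A ** X) ** (A ** Y)"
    using X Y by simp
  also have "\<dots> = (X ** A ** X) ** A ** Y"
    by (simp only: matrix_mul_assoc)
  also have "\<dots> = X ** A ** Y"
    using X by simp
  finally have XAY: "X = X ** A ** Y" .
  have "Y = transpose (Y ** A) ** Y"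
    using Y by simp
  also have "\<dots> = transpose (A ** X ** A) ** transpose Y ** Y"
    using X by (simp add: matrix_transpose_mul)
  also have "\<dots> = transpose (X ** A) ** transpose (Y ** A) ** Y"
    by (simp add: matrix_transpose_mul matrix_mul_assoc)
  also have "\<dots> = X ** A ** (Y ** A) ** Y"
    using X Y by simp
  also have "\<dots> = X ** A ** (Y ** A ** Y)"
    by (simp only: matrix_mul_assoc)
  also have "\<dots> = X ** A ** Y"
    using Y by simp
  finally show ?thesis
    using XAY by simp
qed

lemma sym_mat_range_orthogonal_kernel:
  "sym_mat (D::real^'n^'n) \<Longrightarrow> D *v z = 0 \<Longrightarrow> (D *v w) \<bullet> z = 0"
  by (metis sym_mat_inner_commute inner_zero_right)

lemma sym_mat_range_kernel_decomp:
  fixes D :: "real^'n^'n"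
  assumes "sym_mat D"
  obtains y z where "x = y + z" "y \<in> range ((*v) D)" "D *v z = 0"
proof -
  let ?V = "range ((*v) D)"
  have "subspace ?V"
    by (simp add: real_vector.linear_subspace_image)
  obtain y z where y: "y \<in> span ?V" and z: "\<And>w. w \<in> span ?V \<Longrightarrow> orthogonal z w"
    and "x = y + z"
    using orthogonal_subspace_decomp_exists[of ?V x] by blast
  have "z \<bullet> (D *v (D *v z)) = 0"
    using z by (simp add: orthogonal_def span_base)
  then have "D *v z = 0"
    using sym_mat_inner_commute[OF assms, of z "D *v z"] by simp
  moreover have "y \<in> ?V"
    using y \<open>subspace ?V\<close> by (metis span_eq_iff)
  ultimately show ?thesis
    using that \<open>x = y + z\<close> by blast
qed

lemma sym_mat_inverse_on_range:
  fixes D :: "real^'n^'n"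
  assumes "sym_mat D"
  obtains g where "linear g" "range g \<subseteq> range ((*v) D)"
    "\<And>y. y \<in> range ((*v) D) \<Longrightarrow> g (D *v y) = y"
    "\<And>y. y \<in> range ((*v) D) \<Longrightarrow> D *v g y = y"
proof -
  let ?V = "range ((*v) D)"
  have "subspace ?V"
    by (simp add: real_vector.linear_subspace_image)
  have range_kernel_trivial: "y = 0" if "y \<in> ?V" "D *v y = 0" for y
  proof -
    obtain w where "y = D *v w"
      using \<open>y \<in> ?V\<close> by blast
    then have "y \<bullet> y = (D *v w) \<bullet> y"
      by simp
    also have "\<dots> = 0"
      using sym_mat_range_orthogonal_kernel[OF assms \<open>D *v y = 0\<close>] .
    finally show ?thesis by simp
  qed
  have inj: "inj_on ((*v) D) ?V"
  proof (intro inj_onI)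
    fix a b
    assume "a \<in> ?V" "b \<in> ?V" "D *v a = D *v b"
    then have "a - b \<in> ?V" "D *v (a - b) = 0"
      using \<open>subspace ?V\<close> by (simp_all add: subspace_diff matrix_vector_mult_diff_distrib)
    then show "a = b"
      using range_kernel_trivial[of "a - b"] by simp
  qed
  obtain g where g: "range g \<subseteq> ?V" "linear g" "\<And>y. y \<in> ?V \<Longrightarrow> g (D *v y) = y"
    using linear_exists_left_inverse_on[OF matrix_vector_mul_linear \<open>subspace ?V\<close> inj] by blast
  have "D *v g y = y" if y: "y \<in> ?V" for y
  proof -
    obtain w where "y = D *v w"
      using y by blast
    moreover obtain y' z' where "w = y' + z'" "y' \<in> ?V" "D *v z' = 0"
      using sym_mat_range_kernel_decomp[OF assms] by blast
    ultimately have "y = D *v y'"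
      by (simp add: matrix_vector_right_distrib)
    then show ?thesis
      using g(3) \<open>y' \<in> ?V\<close> by simp
  qed
  with g show ?thesis
    by (intro that)
qed

lemma sym_mat_penrose_inverseI:
  fixes D X :: "real^'n^'n"
  assumes "sym_mat D"
    and proj: "\<And>x y z. x = y + z \<Longrightarrow> y \<in> range ((*v) D) \<Longrightarrow> D *v z = 0 \<Longrightarrow>
                 (D ** X) *v x = y \<and> (X ** D) *v x = y"
    and range: "\<And>x. X *v x \<in> range ((*v) D)"
  shows "penrose_inverse D X"
proof -
  let ?V = "range ((*v) D)"
  have DX_XD: "D ** X = X ** D"
    unfolding matrix_eq
  proof
    fix x
    obtain y z where "x = y + z" "y \<in> ?V" "D *v z = 0"
      using sym_mat_range_kernel_decomp[OF assms(1)] by blast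
    then show "(D ** X) *v x = (X ** D) *v x"
      using proj by simp
  qed
  have DXD: "D ** X ** D = D"
    unfolding matrix_eq
  proof
    fix x
    obtain y z where yz: "x = y + z" "y \<in> ?V" "D *v z = 0"
      using sym_mat_range_kernel_decomp[OF assms(1)] by blast
    then have "(D ** X ** D) *v x = D *v y"
      using proj[OF yz] by (simp add: matrix_vector_mul_assoc[symmetric] matrix_mul_assoc)
    then show "(D ** X ** D) *v x = D *v x"
      using yz by (simp add: matrix_vector_right_distrib)
  qed
  have XDX: "X ** D ** X = X"
    unfolding matrix_eq
  proof
    fix x
    show "(X ** D ** X) *v x = X *v x"
      using proj[of "X *v x" "X *v x" 0] range by (simp add: matrix_vector_mul_assoc[symmetric])
  qed
  have "sym_mat (D ** X)"
  proof (rule sym_matI)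
    fix x x'
    obtain y z where yz: "x = y + z" "y \<in> ?V" "D *v z = 0"
      using sym_mat_range_kernel_decomp[OF assms(1)] by blast
    obtain y' z' where yz': "x' = y' + z'" "y' \<in> ?V" "D *v z' = 0"
      using sym_mat_range_kernel_decomp[OF assms(1)] by blast
    have "y \<bullet> z' = 0" "z \<bullet> y' = 0"
      using yz(2,3) yz'(2,3) sym_mat_range_orthogonal_kernel[OF assms(1)]
      by (auto simp: inner_commute)
    then show "((D ** X) *v x) \<bullet> x' = x \<bullet> ((D ** X) *v x')"
      using proj[OF yz] proj[OF yz'] yz(1) yz'(1) by (simp add: inner_add_left inner_add_right)
  qed
  then show ?thesis
    unfolding penrose_inverse_def sym_mat_def using DX_XD DXD XDX by simp
qed

text \<open>With \<open>g\<close> the inverse of \<open>D\<close> on its range, \<open>X = g \<circ> g \<circ> D\<close> makes both \<open>D X\<close> and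
  \<open>X D\<close> the orthogonal projection onto the range of \<open>D\<close>.\<close>
lemma sym_mat_penrose_inverse_exists:
  fixes D :: "real^'n^'n"
  assumes "sym_mat D"
  shows "\<exists>X. penrose_inverse D X"
proof -
  let ?V = "range ((*v) D)"
  obtain g where g: "linear g" "range g \<subseteq> ?V" "\<And>y. y \<in> ?V \<Longrightarrow> g (D *v y) = y"
    "\<And>y. y \<in> ?V \<Longrightarrow> D *v g y = y"
    using sym_mat_inverse_on_range[OF assms] by blast
  define X where "X = matrix (\<lambda>x. g (g (D *v x)))"
  have "linear (g \<circ> (g \<circ> (*v) D))"
    by (intro linear_compose g(1) matrix_vector_mul_linear)
  then have Xv: "X *v x = g (g (D *v x))" for x
    unfolding X_def by (simp add: o_def matrix_works)
  have "penrose_inverse D X"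
  proof (rule sym_mat_penrose_inverseI[OF assms])
    fix x y z
    assume "x = y + z" "y \<in> ?V" "D *v z = 0"
    then have "D *v x = D *v y"
      by (simp add: matrix_vector_right_distrib)
    then show "(D ** X) *v x = y \<and> (X ** D) *v x = y"
      using g(3,4) \<open>y \<in> ?V\<close> Xv by (simp add: matrix_vector_mul_assoc[symmetric])
  next
    show "X *v x \<in> ?V" for x
      using Xv g(2) by auto
  qed
  then show ?thesis ..
qed

lemma sym_mat_pinv:
  assumes "sym_mat (D::real^'n^'n)"
  shows "penrose_inverse D (pinv D)"
proof -
  obtain X where X: "penrose_inverse D X"
    using sym_mat_penrose_inverse_exists[OF assms] by blast
  have "pinv D = X"
    unfolding pinv_def penrose_inverse_def[symmetric]
    using X penrose_inverse_unique by (intro the_equality)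
  with X show ?thesis by simp
qed

section \<open>Block vectors and the set \<open>\<Z>\<^sub>r\<close>\<close>

definition join :: "real^'q::finite \<Rightarrow> real^'r::finite \<Rightarrow> real^('q + 'r)" where
  "join x y = (\<chi> i. case i of Inl a \<Rightarrow> x $ a | Inr b \<Rightarrow> y $ b)"

lemma join_nth [simp]:
  "join x y $ Inl a = x $ a"
  "join x y $ Inr b = y $ b"
  by (simp_all add: join_def)

lemma join_upper_lower: "v = join (\<chi> a. v $ Inl a) (\<chi> b. v $ Inr b)"
  by (simp add: vec_eq_iff join_def split: sum.split)

lemma sum_UNIV_Plus:
  "(\<Sum>i\<in>(UNIV::('a::finite + 'b::finite) set). f i) = (\<Sum>a\<in>UNIV. f (Inl a)) + (\<Sum>b\<in>UNIV. f (Inr b))"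
  using sum.Plus[of "UNIV::'a set" "UNIV::'b set" f] by (simp add: o_def)

lemma quadratic_form_join:
  "join x y \<bullet> (N *v join x y) =
     x \<bullet> (blk11 N *v x) + x \<bullet> (blk12 N *v y) + y \<bullet> (blk21 N *v x) + y \<bullet> (blk22 N *v y)"
proof -
  have upper: "(\<chi> a. (N *v join x y) $ Inl a) = blk11 N *v x + blk12 N *v y"
    by (simp add: vec_eq_iff matrix_vector_mult_def sum_UNIV_Plus blk11_def blk12_def)
  have lower: "(\<chi> b. (N *v join x y) $ Inr b) = blk21 N *v x + blk22 N *v y"
    by (simp add: vec_eq_iff matrix_vector_mult_def sum_UNIV_Plus blk21_def blk22_def)
  have "join x y \<bullet> v = x \<bullet> (\<chi> a. v $ Inl a) + y \<bullet> (\<chi> b. v $ Inr b)" for v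
    by (simp add: inner_vec_def sum_UNIV_Plus)
  then show ?thesis
    by (simp add: upper lower inner_add_right)
qed

lemma stackI_mult_vec: "stackI Z *v x = join x (Z *v x)"
proof -
  have "(if P then 1 else 0) * (c::real) = (if P then c else 0)" for P c
    by simp
  then show ?thesis
    by (simp add: vec_eq_iff matrix_vector_mult_def stackI_def join_def split: sum.split)
qed

lemma Zr_iff:
  assumes "sym_mat P"
  shows "Z \<in> Zr P \<longleftrightarrow> (\<forall>x. 0 \<le> join x (Z *v x) \<bullet> (P *v join x (Z *v x)))"
proof -
  have "sym_mat (transpose (stackI Z) ** P ** stackI Z)"
    using assms unfolding sym_mat_def by (simp add: matrix_transpose_mul matrix_mul_assoc)
  moreover have "x \<bullet> ((transpose (stackI Z) ** P ** stackI Z) *v x) =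
                 join x (Z *v x) \<bullet> (P *v join x (Z *v x))" for x
    using inner_matrix_vector_transpose[of x "transpose (stackI Z)"]
    by (simp add: matrix_vector_mul_assoc[symmetric] stackI_mult_vec)
  ultimately show ?thesis
    unfolding Zr_def psd_def by simp
qed

lemma psd_diff_imp_Zr_subset:
  assumes "sym_mat M" "sym_mat N" "\<alpha> \<ge> 0" "psd (M - \<alpha> *\<^sub>R N)"
  shows "Zr N \<subseteq> Zr M"
proof
  fix Z
  assume "Z \<in> Zr N"
  show "Z \<in> Zr M"
    unfolding Zr_iff[OF \<open>sym_mat M\<close>]
  proof
    fix x
    let ?v = "join x (Z *v x)"
    have "0 \<le> ?v \<bullet> (N *v ?v)"
      using \<open>Z \<in> Zr N\<close> unfolding Zr_iff[OF \<open>sym_mat N\<close>] by blast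
    then have "0 \<le> \<alpha> * (?v \<bullet> (N *v ?v))"
      using \<open>\<alpha> \<ge> 0\<close> by simp
    moreover have "0 \<le> ?v \<bullet> ((M - \<alpha> *\<^sub>R N) *v ?v)"
      using \<open>psd (M - \<alpha> *\<^sub>R N)\<close> by (simp add: psd_def)
    ultimately show "0 \<le> ?v \<bullet> (M *v ?v)"
      by (simp add: quadratic_form_diff_scaleR)
  qed
qed

section \<open>Completing the square\<close>

lemma sym_mat_pinv_cancel_range:
  fixes D :: "real^'n^'n" and C :: "real^'m^'n"
  assumes "sym_mat D" and ker: "mker D \<subseteq> mker (transpose C)"
  shows "D *v (pinv D *v (C *v x)) = C *v x"
proof -
  define P where "P = D ** pinv D"
  have DXD: "D ** pinv D ** D = D" and "transpose P = P"
    using sym_mat_pinv[OF assms(1)] unfolding P_def penrose_inverse_def by auto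
  have DP: "D ** P = D"
    using arg_cong[OF DXD, of transpose] \<open>sym_mat D\<close> \<open>transpose P = P\<close>
    by (simp add: sym_mat_def matrix_transpose_mul P_def)
  have PP: "P ** P = P"
    using DXD by (simp add: P_def matrix_mul_assoc)
  define u where "u = C *v x - P *v (C *v x)"
  have "D *v u = 0"
    using DP by (simp add: u_def matrix_vector_mult_diff_distrib matrix_vector_mul_assoc matrix_mul_assoc)
  then have "transpose C *v u = 0"
    using ker by (auto simp: mker_def)
  then have "u \<bullet> (C *v x) = 0"
    by (simp add: inner_matrix_vector_transpose)
  moreover have "u \<bullet> (P *v (C *v x)) = 0"
  proof -
    have "P *v u = 0"
      using PP by (simp add: u_def matrix_vector_mult_diff_distrib matrix_vector_mul_assoc matrix_mul_assoc)
    then show ?thesis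
      using inner_matrix_vector_transpose[of u P] \<open>transpose P = P\<close> by simp
  qed
  ultimately have "u \<bullet> u = 0"
    by (simp add: u_def inner_diff_right)
  then have "P *v (C *v x) = C *v x"
    by (simp add: u_def)
  then show ?thesis
    by (simp add: P_def matrix_vector_mul_assoc matrix_mul_assoc)
qed

definition schur_factor :: "real^('q::finite + 'r::finite)^('q + 'r) \<Rightarrow> real^'q^'r" where
  "schur_factor N = pinv (blk22 N) ** blk21 N"

lemma transpose_blk21: "sym_mat N \<Longrightarrow> transpose (blk21 N) = blk12 N"
  unfolding sym_mat_def by (simp add: vec_eq_iff transpose_def blk12_def blk21_def)

lemma sym_mat_blk22: "sym_mat N \<Longrightarrow> sym_mat (blk22 N)"
  unfolding sym_mat_def by (simp add: vec_eq_iff transpose_def blk22_def)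

lemma PiSet_blk21_eq:
  assumes "N \<in> PiSet"
  shows "blk21 N *v x = blk22 N *v (schur_factor N *v x)"
proof -
  have "sym_mat N" "mker (blk22 N) \<subseteq> mker (blk12 N)"
    using assms by (auto simp: PiSet_def)
  then show ?thesis
    using sym_mat_pinv_cancel_range[OF sym_mat_blk22, of N "blk21 N" x]
    by (simp add: transpose_blk21 schur_factor_def matrix_vector_mul_assoc)
qed

lemma PiSet_quadratic_form_complete_square:
  assumes "N \<in> PiSet"
  defines "Y \<equiv> schur_factor N"
  shows "join x (w - Y *v x) \<bullet> (N *v join x (w - Y *v x)) =
         x \<bullet> (schur N *v x) + w \<bullet> (blk22 N *v w)"
proof -
  let ?D = "blk22 N"
  define c where "c = Y *v x"
  have "sym_mat N"
    using assms by (simp add: PiSet_def)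
  then have "sym_mat ?D"
    by (rule sym_mat_blk22)
  have N21: "blk21 N *v x = ?D *v c"
    using PiSet_blk21_eq[OF assms(1)] by (simp add: c_def Y_def)
  have N12: "x \<bullet> (blk12 N *v z) = (?D *v c) \<bullet> z" for z
    using inner_matrix_vector_transpose[of x "blk12 N" z] N21
      transpose_blk21[OF \<open>sym_mat N\<close>, symmetric] by simp
  have "schur N *v x = blk11 N *v x - blk12 N *v c"
    by (simp add: schur_def c_def Y_def schur_factor_def matrix_vector_mult_diff_rdistrib
        matrix_vector_mul_assoc matrix_mul_assoc)
  then have S: "x \<bullet> (schur N *v x) = x \<bullet> (blk11 N *v x) - (?D *v c) \<bullet> c"
    by (simp add: inner_diff_right N12)
  have "(?D *v c) \<bullet> w = c \<bullet> (?D *v w)"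
    using sym_mat_inner_commute[OF \<open>sym_mat ?D\<close>, of c w] by simp
  then show ?thesis
    unfolding quadratic_form_join N12 N21 S c_def[symmetric]
    by (simp add: inner_diff_left inner_diff_right matrix_vector_mult_diff_distrib inner_commute)
qed

definition outer :: "real^'m \<Rightarrow> real^'n \<Rightarrow> real^'n^'m" where
  "outer w l = (\<chi> i j. w $ i * l $ j)"

lemma outer_mult_vec: "outer w l *v x = (l \<bullet> x) *\<^sub>R w"
  by (simp add: outer_def vec_eq_iff matrix_vector_mult_def inner_vec_def sum_distrib_left mult_ac)

lemma PiSet_rank_one_mem_Zr:
  assumes "N \<in> PiSet"
    and bound: "\<And>x. 0 \<le> x \<bullet> (schur N *v x) + (l \<bullet> x)^2 * (w \<bullet> (blk22 N *v w))"
  shows "outer w l - schur_factor N \<in> Zr N"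
proof -
  have "sym_mat N"
    using assms by (simp add: PiSet_def)
  have "(outer w l - schur_factor N) *v x = (l \<bullet> x) *\<^sub>R w - schur_factor N *v x" for x
    by (simp add: matrix_vector_mult_diff_rdistrib outer_mult_vec)
  then show ?thesis
    unfolding Zr_iff[OF \<open>sym_mat N\<close>]
    using PiSet_quadratic_form_complete_square[OF assms(1)] bound
    by (simp add: matrix_vector_mult_scaleR power2_eq_square mult_ac)
qed

section \<open>Inclusion of the sets \<open>\<Z>\<^sub>r\<close> and the quadratic forms\<close>

lemma PiSet_psd_schur: "N \<in> PiSet \<Longrightarrow> psd (schur N)"
  and PiSet_blk22_nonpos: "N \<in> PiSet \<Longrightarrow> y \<bullet> (blk22 N *v y) \<le> 0"
  by (simp_all add: PiSet_def nsd_def)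

text \<open>The matrices \<open>t y e\<^sup>T - Y\<close> all lie in \<open>\<Z>\<^sub>r(N)\<close>; evaluated at the unit vector \<open>e\<close> they give a
  quadratic in \<open>t\<close> whose leading coefficient is the claimed quantity.\<close>
lemma PiSet_Zr_subset_imp_lower_nonneg:
  fixes M N :: "real^('q::finite + 'r::finite)^('q + 'r)"
  assumes "N \<in> PiSet" "sym_mat M" "Zr N \<subseteq> Zr M" "y \<bullet> (blk22 N *v y) = 0"
  shows "0 \<le> join 0 y \<bullet> (M *v join 0 y)"
proof -
  fix i :: 'q
  let ?Y = "schur_factor N"
  define e :: "real^'q" where "e = axis i 1"
  let ?a = "join e (- (?Y *v e))" and ?b = "join (0::real^'q) y"
  have "0 \<le> (?a + t *\<^sub>R ?b) \<bullet> (M *v (?a + t *\<^sub>R ?b))" for t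
  proof -
    have "outer (t *\<^sub>R y) e - ?Y \<in> Zr M"
      using PiSet_rank_one_mem_Zr[OF assms(1)] assms(3,4) PiSet_psd_schur[OF assms(1)]
      by (auto simp: psd_def matrix_vector_mult_scaleR)
    moreover have "(outer (t *\<^sub>R y) e - ?Y) *v e = t *\<^sub>R y - ?Y *v e"
      by (simp add: matrix_vector_mult_diff_rdistrib outer_mult_vec e_def)
    moreover have "join e (t *\<^sub>R y - ?Y *v e) = ?a + t *\<^sub>R ?b"
      by (simp add: vec_eq_iff join_def split: sum.split)
    ultimately show ?thesis
      unfolding Zr_iff[OF assms(2)] by metis
  qed
  then have "0 \<le> ?a \<bullet> (M *v ?a) + 2 * (?a \<bullet> (M *v ?b)) * t + (?b \<bullet> (M *v ?b)) * t^2" for t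
    using quadratic_form_add_scaleR[OF assms(2)] by simp
  then show ?thesis
    using nonneg_quadratic_coeffs by blast
qed

lemma PiSet_Zr_subset_imp_quadratic_form_nonneg:
  fixes M N :: "real^('q::finite + 'r::finite)^('q + 'r)"
  assumes "N \<in> PiSet" "sym_mat M" "Zr N \<subseteq> Zr M" "0 \<le> v \<bullet> (N *v v)"
  shows "0 \<le> v \<bullet> (M *v v)"
proof -
  let ?Y = "schur_factor N"
  define x where "x = (\<chi> a. v $ Inl a)"
  define w where "w = (\<chi> b. v $ Inr b) + ?Y *v x"
  have v: "v = join x (w - ?Y *v x)"
    unfolding x_def w_def by (simp add: join_upper_lower[symmetric])
  have nonneg: "0 \<le> x \<bullet> (schur N *v x) + w \<bullet> (blk22 N *v w)"
    using assms(4) PiSet_quadratic_form_complete_square[OF assms(1), of x w] v by simp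
  show ?thesis
  proof (cases "x = 0")
    case True
    then have "w \<bullet> (blk22 N *v w) = 0"
      using nonneg PiSet_blk22_nonpos[OF assms(1), of w] by simp
    then show ?thesis
      using PiSet_Zr_subset_imp_lower_nonneg[OF assms(1-3)] v True by simp
  next
    case False
    obtain l where "l \<bullet> x = 1"
      and "\<And>x'. 0 \<le> x' \<bullet> (schur N *v x') + (l \<bullet> x')^2 * (w \<bullet> (blk22 N *v w))"
      using psd_rank_one_perturbation[OF PiSet_psd_schur[OF assms(1)] False nonneg
          PiSet_blk22_nonpos[OF assms(1)]] by blast
    then have "outer w l - ?Y \<in> Zr M"
      using PiSet_rank_one_mem_Zr[OF assms(1)] assms(3) by blast
    moreover have "(outer w l - ?Y) *v x = w - ?Y *v x"
      using \<open>l \<bullet> x = 1\<close> by (simp add: matrix_vector_mult_diff_rdistrib outer_mult_vec)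
    ultimately show ?thesis
      unfolding Zr_iff[OF assms(2)] v by metis
  qed
qed

theorem mainTheorem8:
  fixes M N :: "real^('q::finite + 'r::finite)^('q + 'r)"
  assumes "sym_mat M" and "sym_mat N"
  shows "((\<exists>\<alpha>::real. \<alpha> \<ge> 0 \<and> psd (M - \<alpha> *\<^sub>R N)) \<longrightarrow> Zr N \<subseteq> Zr M) \<and>
         (N \<in> PiSet \<and> has_pos_eigenvalue N \<longrightarrow>
            (Zr N \<subseteq> Zr M \<longleftrightarrow> (\<exists>\<alpha>::real. \<alpha> \<ge> 0 \<and> psd (M - \<alpha> *\<^sub>R N))))"
proof -
  have sufficient: "Zr N \<subseteq> Zr M" if "\<exists>\<alpha>::real. \<alpha> \<ge> 0 \<and> psd (M - \<alpha> *\<^sub>R N)"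
    using that psd_diff_imp_Zr_subset[OF assms] by blast
  have necessary: "\<exists>\<alpha>::real. \<alpha> \<ge> 0 \<and> psd (M - \<alpha> *\<^sub>R N)"
    if Pi: "N \<in> PiSet" and eig: "has_pos_eigenvalue N" and incl: "Zr N \<subseteq> Zr M"
  proof -
    obtain v0 where "0 < v0 \<bullet> (N *v v0)"
      using has_pos_eigenvalue_imp_quadratic_form_pos[OF eig] by blast
    then show ?thesis
      using S_lemma[OF assms(2,1)] PiSet_Zr_subset_imp_quadratic_form_nonneg[OF Pi assms(1) incl]
      by blast
  qed
  show ?thesis
    using sufficient necessary by blast
qed

end
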